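(* For every positive integer $n$, $\operatorname{pqn}(K_{n,n}) \ge \left\lceil \frac{3-\sqrt{5}}{4}\, n\right\rceil$, where $K_{n,n}$ is the complete bipartite graph with both classes of size $n$.
   Context: All graphs are finite, simple and undirected. An edge-weighted graph $\langle G,w\rangle$ is a graph $G=(V,E)$ with $w\colon E\to\mathbb{R}$. A PQ-layout of $\langle G,w\rangle$ with $k$ priority queues consists of a linear ordering $\prec$ of $V$ and a partition of $E$ into $k$ sets $\mathcal{P}_1,\dots,\mathcal{P}_k$ such that there is no $i$ and no two edges $e=uv$, $e'=u'v'$ in $\mathcal{P}_i$ with $w(e)>w(e')$ and $u\prec v$, $u'\prec v$, $v\prec v'$. $\operatorname{pqn}(G,w)$ is the minimum $k\ge0$ such that $\langle G,w\rangle$ has a PQ-layout with $k$ priority queues, and $\operatorname{pqn}(G)$ is the minimum $k\ge0$ such that $\operatorname{pqn}(G,w)\le k$ for every $w\colon E\to\mathbb{R}$. *)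

theory Defs
  imports Complex_Main "HOL-Library.Disjoint_Sets"
begin

definition simple_graph :: "'a set \<Rightarrow> 'a set set \<Rightarrow> bool" where
  "simple_graph V E \<longleftrightarrow>
     finite V \<and> (\<forall>e\<in>E. \<exists>u v. u \<in> V \<and> v \<in> V \<and> u \<noteq> v \<and> e = {u, v})"

(* The linear ordering of V is the reflexive relation r; the strict order "u before v" is
   (u, v) : r - Id.  Since {u, v} = {v, u}, the quantifiers over u, v, u', v' range over both
   ways of naming the ends of each edge. The classes P i may be empty, which does not affect the
   minimum number of classes. *)
definition pq_layout ::
    "'a set \<Rightarrow> 'a set set \<Rightarrow> ('a set \<Rightarrow> real) \<Rightarrow> nat \<Rightarrow> ('a \<times> 'a) set \<Rightarrow> (nat \<Rightarrow> 'a set set) \<Rightarrow> bool" where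
  "pq_layout V E w k r P \<longleftrightarrow>
     linear_order_on V r \<and>
     disjoint_family_on P {..<k} \<and> (\<Union>i<k. P i) = E \<and>
     \<not> (\<exists>i<k. \<exists>u v u' v'. {u, v} \<in> P i \<and> {u', v'} \<in> P i \<and> w {u, v} > w {u', v'} \<and>
           (u, v) \<in> r - Id \<and> (u', v) \<in> r - Id \<and> (v, v') \<in> r - Id)"

definition pqn_weighted :: "'a set \<Rightarrow> 'a set set \<Rightarrow> ('a set \<Rightarrow> real) \<Rightarrow> nat" where
  "pqn_weighted V E w = (LEAST k. \<exists>r P. pq_layout V E w k r P)"

(* Weightings are total functions on sets of vertices; only their values on E matter. *)
definition pqn :: "'a set \<Rightarrow> 'a set set \<Rightarrow> nat" where
  "pqn V E = (LEAST k. \<forall>w. pqn_weighted V E w \<le> k)"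

definition complete_bipartite_verts :: "nat \<Rightarrow> nat \<Rightarrow> (nat + nat) set" where
  "complete_bipartite_verts m n = {..<m} <+> {..<n}"

definition complete_bipartite_edges :: "nat \<Rightarrow> nat \<Rightarrow> (nat + nat) set set" where
  "complete_bipartite_edges m n = {{Inl i, Inr j} | i j. i < m \<and> j < n}"

lemma simple_graph_complete_bipartite:
  "simple_graph (complete_bipartite_verts m n) (complete_bipartite_edges m n)"
  unfolding simple_graph_def complete_bipartite_verts_def complete_bipartite_edges_def
  by (fastforce intro!: finite_Plus)

(* Both minima are attained: giving every edge its own queue is always a layout. *)

lemma simple_graph_finite_edges:
  assumes "simple_graph V E"
  shows "finite E"
proof (rule finite_subset)
  show "E \<subseteq> Pow V"
    using assms unfolding simple_graph_def by fastforce
  show "finite (Pow V)"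
    using assms by (simp add: simple_graph_def)
qed

lemma pq_layout_card_edges:
  assumes "simple_graph V E"
  shows "\<exists>r P. pq_layout V E w (card E) r P"
proof -
  obtain f where f: "bij_betw f {..<card E} E"
    using ex_bij_betw_nat_finite[OF simple_graph_finite_edges[OF assms]]
    by (auto simp: atLeast0LessThan)
  obtain r where "well_order_on V r"
    using well_order_on by blast
  then have "linear_order_on V r"
    by (simp add: well_order_on_def)
  moreover have "disjoint_family_on (\<lambda>i. {f i}) {..<card E}"
    using f by (auto simp: disjoint_family_on_def bij_betw_def inj_on_def)
  moreover have "(\<Union>i<card E. {f i}) = E"
    using f by (auto simp: bij_betw_def)
  ultimately have "pq_layout V E w (card E) r (\<lambda>i. {f i})"
    unfolding pq_layout_def by auto
  then show ?thesis
    by blast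
qed

lemma pqn_weighted_layout:
  assumes "simple_graph V E"
  shows "\<exists>r P. pq_layout V E w (pqn_weighted V E w) r P"
  unfolding pqn_weighted_def by (rule LeastI_ex) (use pq_layout_card_edges[OF assms] in blast)

lemma pqn_weighted_le_pqn:
  assumes "simple_graph V E"
  shows "pqn_weighted V E w \<le> pqn V E"
proof -
  have "pqn_weighted V E w' \<le> card E" for w'
    unfolding pqn_weighted_def by (rule Least_le) (rule pq_layout_card_edges[OF assms])
  then have "\<forall>w. pqn_weighted V E w \<le> pqn V E"
    unfolding pqn_def by (intro LeastI_ex[where P = "\<lambda>k. \<forall>w. pqn_weighted V E w \<le> k"]) blast
  then show ?thesis
    by blast
qed

end

theory Submission
  imports Defs "HOL-Number_Theory.Cong"
begin

text \<open>
  Weight the edges of \<open>K\<^sub>n\<^sub>,\<^sub>n\<close> by the cyclic Latin square, \<open>w(a\<^sub>i b\<^sub>j) = (i + j) mod n\<close>, and cut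
  the vertex order in the middle. If \<open>x\<close> vertices of one class and \<open>n - x\<close> of the other lie
  left of the cut, then \<open>x\<^sup>2 + (n - x)\<^sup>2 \<ge> n\<^sup>2 / 2\<close> edges cross it. A crossing edge is determined
  by its right end and its weight, and inside one queue the weights of the crossing edges are weakly
  increasing in the position of the right end. So one queue holds a chain of the
  \<open>n \<times> n\<close> grid of pairs (right end, weight), that is at most \<open>2n - 1\<close> crossing edges. Therefore
  \<open>k (2n - 1) \<ge> n\<^sup>2 / 2\<close>, which gives \<open>k \<ge> n / 4\<close>, and \<open>1 / 4 \<ge> (3 - \<surd>5) / 4\<close>.
\<close>

text \<open>The rank of a vertex is the number of its strict predecessors. Numeric positions let the
  order be cut after exactly half of the vertices and let right ends be compared as numbers.\<close>

lemma linear_order_on_rank: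
  assumes fin: "finite V" and lin: "linear_order_on V r"
  obtains p where "bij_betw p V {..<card V}"
    and "\<And>u v. u \<in> V \<Longrightarrow> v \<in> V \<Longrightarrow> p u < p v \<longleftrightarrow> (u, v) \<in> r - Id"
proof -
  define below where "below v = {u \<in> V. (u, v) \<in> r - Id}" for v
  define p where "p v = card (below v)" for v
  have tr: "trans r" and anti: "antisym r" and tot: "total_on V r"
    using lin by (auto simp: linear_order_on_def partial_order_on_def preorder_on_def)
  have mono: "p u < p v" if "u \<in> V" "v \<in> V" "(u, v) \<in> r - Id" for u v
  proof -
    have "below u \<subset> below v"
      using that tr anti unfolding below_def by (blast dest: transD antisymD)
    then show ?thesis
      unfolding p_def by (intro psubset_card_mono) (use fin in \<open>auto simp: below_def\<close>)
  qed
  have iff: "p u < p v \<longleftrightarrow> (u, v) \<in> r - Id" if "u \<in> V" "v \<in> V" for u v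
    using that mono[of u v] mono[of v u] tot
    by (metis DiffI less_asym less_irrefl pair_in_Id_conv total_on_def)
  have "inj_on p V"
  proof (rule inj_onI)
    fix u v assume uv: "u \<in> V" "v \<in> V" "p u = p v"
    then show "u = v"
      using mono[of u v] mono[of v u] tot by (auto simp: total_on_def)
  qed
  moreover have "p ` V \<subseteq> {..<card V}"
  proof
    fix m assume "m \<in> p ` V"
    then obtain v where v: "v \<in> V" "m = p v" by blast
    then have "below v \<subset> V" by (auto simp: below_def)
    then show "m \<in> {..<card V}"
      using v fin by (simp add: p_def psubset_card_mono)
  qed
  ultimately have "bij_betw p V {..<card V}"
    by (simp add: bij_betw_def card_image card_subset_eq)
  with iff show thesis by (rule_tac that)
qed

text \<open>Edges are unordered sets, so the weight is a sum over the members. The ends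
  \<open>Inl i\<close> and \<open>Inr j\<close> are distinct even if \<open>i = j\<close>, so
  neither summand is lost.\<close>

definition latin_weight :: "nat \<Rightarrow> (nat + nat) set \<Rightarrow> real" where
  "latin_weight n e = real ((\<Sum>x\<in>e. case_sum id id x) mod n)"

lemma latin_weight_edge: "latin_weight n {Inl i, Inr j} = real ((i + j) mod n)"
  by (simp add: latin_weight_def)

lemma latin_square_inj:
  fixes i j j' n :: nat
  assumes "(i + j) mod n = (i + j') mod n" "j < n" "j' < n"
  shows "j = j'"
  using assms by (metis cong_add_lcancel_nat cong_def mod_less)

lemma pq_layout_latin_weight_bound:
  assumes lay: "pq_layout (complete_bipartite_verts n n) (complete_bipartite_edges n n)
                  (latin_weight n) k r P"
  shows "n * n \<le> 2 * k * (2 * n - 1)"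
proof -
  let ?V = "complete_bipartite_verts n n"
  have V: "finite ?V" "card ?V = 2 * n"
    by (auto simp: complete_bipartite_verts_def card_Plus)
  have inV: "Inl i \<in> ?V \<longleftrightarrow> i < n" "Inr i \<in> ?V \<longleftrightarrow> i < n" for i
    by (auto simp: complete_bipartite_verts_def)
  have lin: "linear_order_on ?V r"
    and cover: "(\<Union>q<k. P q) = complete_bipartite_edges n n"
    and no_conflict: "\<And>q u v u' v'. q < k \<Longrightarrow> {u, v} \<in> P q \<Longrightarrow> {u', v'} \<in> P q \<Longrightarrow>
      (u, v) \<in> r - Id \<Longrightarrow> (u', v) \<in> r - Id \<Longrightarrow> (v, v') \<in> r - Id \<Longrightarrow>
      latin_weight n {u, v} \<le> latin_weight n {u', v'}"
    using lay unfolding pq_layout_def not_less[symmetric] by blast+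
  obtain p where bij: "bij_betw p ?V {..<2 * n}"
    and p_less: "\<And>u v. u \<in> ?V \<Longrightarrow> v \<in> ?V \<Longrightarrow> p u < p v \<longleftrightarrow> (u, v) \<in> r - Id"
    using linear_order_on_rank[OF V(1) lin] V(2) by metis
  have inj: "inj_on p ?V" and p_bound: "v \<in> ?V \<Longrightarrow> p v < 2 * n" for v
    using bij by (auto simp: bij_betw_def)

  \<comment> \<open>\<open>X\<close> and \<open>Y\<close> index the vertices of each class among the
    first \<open>n\<close> of the \<open>2 * n\<close> positions; \<open>C\<close> holds the index
    pairs of the edges crossing this cut.\<close>
  define X where "X = {i. i < n \<and> p (Inl i) < n}"
  define Y where "Y = {j. j < n \<and> p (Inr j) < n}"
  define C where "C = X \<times> ({..<n} - Y) \<union> ({..<n} - X) \<times> Y"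
  have sub: "X \<subseteq> {..<n}" "Y \<subseteq> {..<n}"
    by (auto simp: X_def Y_def)
  then have fin: "finite X" "finite Y" "finite C"
    by (auto simp: C_def intro: finite_subset)
  \<comment> \<open>The left side has exactly \<open>n\<close> vertices, so
    \<open>n - card Y = card X\<close> and \<open>n - card X = card Y\<close>, which turns
    \<open>card C\<close> into a sum of two squares.\<close>
  have "p ` (X <+> Y) = {..<n}"
  proof (intro equalityI subsetI)
    fix m assume m: "m \<in> {..<n}"
    then have "m \<in> p ` ?V" using bij by (auto simp: bij_betw_def)
    then show "m \<in> p ` (X <+> Y)"
      using m by (auto simp: X_def Y_def complete_bipartite_verts_def)
  qed (auto simp: X_def Y_def)
  moreover have "inj_on p (X <+> Y)"
    using inj by (rule inj_on_subset) (use sub in \<open>auto simp: complete_bipartite_verts_def\<close>)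
  ultimately have XY: "card X + card Y = n"
    using card_image[of p "X <+> Y"] fin by (simp add: card_Plus)
  have "card C = card X * (n - card Y) + (n - card X) * card Y"
    unfolding C_def using fin sub
    by (subst card_Un_disjoint) (auto simp: card_cartesian_product card_Diff_subset)
  then have "card C = card X * card X + card Y * card Y"
    using XY by (metis add_diff_cancel_left' add_diff_cancel_right')
  moreover have "real ((card X + card Y) * (card X + card Y))
      \<le> real (2 * (card X * card X + card Y * card Y))"
    using sum_squares_bound[of "real (card X)" "real (card Y)"]
    by (simp add: algebra_simps power2_eq_square)
  ultimately have many: "n * n \<le> 2 * card C"
    by (simp add: XY del: of_nat_mult of_nat_add)

  define D where "D q = {(i, j) \<in> C. {Inl i, Inr j} \<in> P q}" for q
  have queue_card: "card (D q) \<le> 2 * n - 1" if q: "q < k" for q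
  proof -
    define right where "right = (\<lambda>(i, j). max (p (Inl i)) (p (Inr j)))"
    define wt where "wt = (\<lambda>(i, j). (i + j) mod n)"
    \<comment> \<open>Each crossing edge is named with its left end \<open>u\<close> and right end
      \<open>v\<close>; which class contains \<open>u\<close> depends on whether
      \<open>fst e\<close> is in \<open>X\<close>.\<close>
    have ends: "\<exists>u v. {u, v} = {Inl (fst e), Inr (snd e)} \<and> u \<in> ?V \<and> v \<in> ?V \<and>
        {u, v} \<in> P q \<and> p u < n \<and> n \<le> p v \<and> right e = p v \<and>
        latin_weight n {u, v} = real (wt e)" if e: "e \<in> D q" for e
    proof (cases "fst e \<in> X")
      case True
      then show ?thesis
        using e by (intro exI[of _ "Inl (fst e)"] exI[of _ "Inr (snd e)"])
          (auto simp: D_def C_def X_def Y_def right_def wt_def latin_weight_edge inV)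
    next
      case False
      then show ?thesis
        using e by (intro exI[of _ "Inr (snd e)"] exI[of _ "Inl (fst e)"])
          (auto simp: D_def C_def X_def Y_def right_def wt_def latin_weight_edge inV
             insert_commute[of "Inr _" "Inl _"])
    qed
    \<comment> \<open>The cut is what makes the forbidden pattern apply: \<open>u'\<close> lies left
      of it and \<open>v\<close> right of it, so \<open>u'\<close> precedes \<open>v\<close>, while
      \<open>less\<close> puts \<open>v\<close> before \<open>v'\<close>.\<close>
    have mono: "wt e \<le> wt e'" if e: "e \<in> D q" and e': "e' \<in> D q" and less: "right e < right e'" for e e'
    proof -
      obtain u v where uv: "u \<in> ?V" "v \<in> ?V" "{u, v} \<in> P q" "p u < n" "n \<le> p v"
          "right e = p v" "latin_weight n {u, v} = real (wt e)"
        using ends[OF e] by blast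
      obtain u' v' where uv': "u' \<in> ?V" "v' \<in> ?V" "{u', v'} \<in> P q" "p u' < n" "n \<le> p v'"
          "right e' = p v'" "latin_weight n {u', v'} = real (wt e')"
        using ends[OF e'] by blast
      have "latin_weight n {u, v} \<le> latin_weight n {u', v'}"
        using uv uv' less q by (intro no_conflict[of q]) (simp_all only: p_less[symmetric])
      then show ?thesis using uv uv' by simp
    qed
    have determined: "e = e'"
      if e: "e \<in> D q" and e': "e' \<in> D q" and "right e = right e'" and "wt e = wt e'" for e e'
    proof -
      obtain u v where uv: "{u, v} = {Inl (fst e), Inr (snd e)}" "v \<in> ?V" "right e = p v"
        using ends[OF e] by blast
      obtain u' v' where uv': "{u', v'} = {Inl (fst e'), Inr (snd e')}" "v' \<in> ?V" "right e' = p v'"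
        using ends[OF e'] by blast
      \<comment> \<open>A common right end fixes one index; equal weights then fix the other by
        cancellation modulo \<open>n\<close>.\<close>
      have "v = v'"
        using inj uv uv' that(3) by (metis inj_onD)
      then have "fst e = fst e' \<or> snd e = snd e'"
        using uv(1) uv'(1) by (auto simp: doubleton_eq_iff)
      moreover have "fst e < n" "snd e < n" "fst e' < n" "snd e' < n"
        using e e' sub by (auto simp: D_def C_def)
      moreover have "(fst e + snd e) mod n = (fst e' + snd e') mod n"
        using that(4) by (simp add: wt_def split_beta)
      ultimately show ?thesis
        by (metis latin_square_inj add.commute prod_eqI)
    qed
    \<comment> \<open>By \<open>mono\<close>, this sum strictly increases with the right end. Since
      \<open>right e\<close> is at least \<open>n\<close>, the subtraction does not
      truncate.\<close>
    have "inj_on (\<lambda>e. right e - n + wt e) (D q)"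
    proof (rule inj_onI)
      fix e e' assume e: "e \<in> D q" "e' \<in> D q" "right e - n + wt e = right e' - n + wt e'"
      have "n \<le> right e" "n \<le> right e'"
        using ends e by metis+
      then have "right e = right e'"
        using mono[of e e'] mono[of e' e] e by linarith
      then show "e = e'" using determined e by auto
    qed
    \<comment> \<open>Both summands are at most \<open>n - 1\<close>, leaving the
      \<open>2 * n - 1\<close> values from \<open>0\<close> to \<open>2 * n - 2\<close>. Positivity
      of \<open>n\<close>, needed for the remainder, follows from
      \<open>n \<le> right e < 2 * n\<close>.\<close>
    moreover have "(\<lambda>e. right e - n + wt e) ` D q \<subseteq> {..<2 * n - 1}"
    proof
      fix m assume "m \<in> (\<lambda>e. right e - n + wt e) ` D q"
      then obtain e where e: "e \<in> D q" "m = right e - n + wt e" by blast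
      then have "n \<le> right e" "right e < 2 * n"
        using ends[OF e(1)] p_bound by auto
      moreover from this have "wt e < n"
        by (simp add: wt_def split_beta)
      ultimately show "m \<in> {..<2 * n - 1}" using e(2) by simp
    qed
    ultimately show ?thesis
      by (metis card_inj_on_le card_lessThan finite_lessThan)
  qed

  have "C \<subseteq> (\<Union>q<k. D q)"
  proof
    fix e assume e: "e \<in> C"
    then have "fst e < n \<and> snd e < n"
      using sub by (auto simp: C_def)
    then have "{Inl (fst e), Inr (snd e)} \<in> complete_bipartite_edges n n"
      unfolding complete_bipartite_edges_def by blast
    then show "e \<in> (\<Union>q<k. D q)"
      using e unfolding cover[symmetric] by (auto simp: D_def)
  qed
  then have "card C \<le> card (\<Union>q<k. D q)"
    by (intro card_mono finite_UN_I) (auto simp: D_def intro: finite_subset[OF _ fin(3)])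
  also have "\<dots> \<le> (\<Sum>q<k. card (D q))"
    by (rule card_UN_le) simp
  also have "\<dots> \<le> (\<Sum>q<k. 2 * n - 1)"
    by (rule sum_mono) (use queue_card in auto)
  finally show ?thesis using many by simp
qed

theorem theorem3p3:
  fixes n :: nat
  assumes "n > 0"
  shows "int (pqn (complete_bipartite_verts n n) (complete_bipartite_edges n n))
           \<ge> \<lceil>(3 - sqrt 5) / 4 * real n\<rceil>"
proof -
  let ?V = "complete_bipartite_verts n n" and ?E = "complete_bipartite_edges n n"
  \<comment> \<open>One weighting suffices, as \<open>pqn\<close> bounds the weighted number for
    every weighting.\<close>
  define k where "k = pqn_weighted ?V ?E (latin_weight n)"
  obtain r P where "pq_layout ?V ?E (latin_weight n) k r P"
    using pqn_weighted_layout[OF simple_graph_complete_bipartite] unfolding k_def by blast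
  then have "n * n \<le> 2 * k * (2 * n - 1)"
    by (rule pq_layout_latin_weight_bound)
  \<comment> \<open>Rounding \<open>2 * n - 1\<close> up to \<open>2 * n\<close> lets a factor
    \<open>n\<close> cancel.\<close>
  also have "\<dots> \<le> 2 * k * (2 * n)"
    by (intro mult_left_mono) auto
  finally have "n * n \<le> (4 * k) * n"
    by (simp add: algebra_simps)
  then have "real n \<le> 4 * real k"
    using assms by (simp flip: of_nat_le_iff[where 'a = real])
  moreover have "2 \<le> sqrt 5"
    by (rule real_le_rsqrt) simp
  then have "(3 - sqrt 5) / 4 * real n \<le> 1 / 4 * real n"
    by (intro mult_right_mono) auto
  ultimately have "(3 - sqrt 5) / 4 * real n \<le> real k"
    by linarith
  also have "k \<le> pqn ?V ?E"
    unfolding k_def by (rule pqn_weighted_le_pqn[OF simple_graph_complete_bipartite])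
  finally show ?thesis
    by (simp add: ceiling_le_iff)
qed

end
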